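(* Let $k$ be a positive integer and $\mathcal{F}$ be a finite family of convex sets in $\mathbb{R}^d$. If the intersection of every $4^d$ or fewer elements of $\mathcal{F}$ contains $k$ colinear integer points, then $\bigcap \mathcal{F}$ contains $k$ colinear integer points.
   Context: An integer point is a point of $\mathbb{Z}^d$. A set contains $k$ colinear integer points if it contains $k$ distinct points of $\mathbb{Z}^d$ lying on a common line. *)

theory Defs
  imports "HOL-Analysis.Analysis"
begin

definition integer_points :: "(real ^ 'n) set" where
  "integer_points = {x. \<forall>i. x $ i \<in> \<int>}"

definition contains_collinear_integer_points :: "nat \<Rightarrow> (real ^ 'n) set \<Rightarrow> bool" where
  "contains_collinear_integer_points k S \<longleftrightarrow>
     (\<exists>P. finite P \<and> card P = k \<and> P \<subseteq> S \<inter> integer_points \<and> collinear P)"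

end

theory Submission
  imports Defs
begin

text \<open>
  The proof lifts the problem to a Helly theorem for lattice points in doubled dimension.  A convex
  set contains \<open>k\<close> collinear integer points iff it contains both ends \<open>x\<close> and \<open>x + (k - 1) v\<close> of an
  arithmetic progression with \<open>x\<close> and \<open>v \<noteq> 0\<close> integral (\<open>progression_of_collinear\<close>,
  \<open>collinear_of_progression\<close>).  For fixed \<open>C\<close> the pairs \<open>(x, v)\<close> whose progression has its ends in
  \<open>C\<close> form a convex set, and Doignon's theorem in dimension \<open>2 d\<close> has Helly number
  \<open>2 ^ (2 d) = 4 ^ d\<close>.

  Doignon's theorem does not apply as it stands, because of the condition \<open>v \<noteq> 0\<close>.  Its proof only
  uses that points of equal parity have their midpoint in the set, and this fails for \<open>v\<close> and \<open>- v\<close>.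
  Reversing a progression replaces \<open>v\<close> by \<open>- v\<close>, so all the finitely many progressions at hand can
  be oriented to satisfy \<open>a \<bullet> v > 0\<close> for one generic \<open>a\<close>
  (\<open>exists_inner_nonzero\<close>), and the integer pairs \<open>(x, v)\<close> with \<open>a \<bullet> v > 0\<close> are closed
  under midpoints of pairs of equal parity.

  The Helly theorem is accordingly proved for every discrete set \<open>S\<close> with a finite colouring in
  which equally coloured points have their midpoint in \<open>S\<close>; its Helly number is the number of
  colours (\<open>helly_midpoint_colouring\<close>).  Separation reduces it to open halfspaces and finite sets
  of points.  For a minimal infeasible family of halfspaces, the bounds can be relaxed until each
  halfspace \<open>h\<close> has a point \<open>p h\<close> on its boundary that is inside all others, while the family stays
  infeasible (\<open>relax_bounds\<close>).  If \<open>p h\<close> and \<open>p h'\<close> had the same colour, their midpoint would be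
  inside all halfspaces; hence there are at most as many halfspaces as colours.
\<close>

section \<open>A Helly theorem for sets closed under midpoints of equally coloured points\<close>

definition infeasible ::
  "'h set \<Rightarrow> ('h \<Rightarrow> 'a::real_inner) \<Rightarrow> ('h \<Rightarrow> real) \<Rightarrow> 'a set \<Rightarrow> bool" where
  "infeasible H a b P \<longleftrightarrow> (\<forall>x\<in>P. \<exists>h\<in>H. \<not> a h \<bullet> x < b h)"

text \<open>
  The bounds are raised one at a time: the new bound of \<open>t\<close> is the least value of \<open>a t \<bullet> x\<close> over the
  points inside the other halfspaces, of which there are some because no halfspace is redundant.
  Raising a bound keeps the points found for earlier
  halfspaces, so the process ends with such a point for every halfspace.
\<close>
lemma relax_bounds:
  assumes "finite H" and "finite P" and inf: "infeasible H a b P"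
    and crit: "\<And>h. h \<in> H \<Longrightarrow> \<not> infeasible (H - {h}) a b P"
  shows "\<exists>b'. infeasible H a b' P \<and>
           (\<forall>h\<in>H. \<exists>x\<in>P. a h \<bullet> x = b' h \<and> (\<forall>h'\<in>H - {h}. a h' \<bullet> x < b' h'))"
proof -
  have "\<exists>b'. (\<forall>h\<in>H. b h \<le> b' h) \<and> infeasible H a b' P \<and>
           (\<forall>h\<in>T. \<exists>x\<in>P. a h \<bullet> x = b' h \<and> (\<forall>h'\<in>H - {h}. a h' \<bullet> x < b' h'))"
    if "finite T" "T \<subseteq> H" for T
    using that
  proof (induction T rule: finite_induct)
    case empty
    then show ?case using inf by auto
  next
    case (insert t T)
    then obtain b' where ge: "\<forall>h\<in>H. b h \<le> b' h" and inf': "infeasible H a b' P"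
      and T: "\<forall>h\<in>T. \<exists>x\<in>P. a h \<bullet> x = b' h \<and> (\<forall>h'\<in>H - {h}. a h' \<bullet> x < b' h')"
      by auto
    have t: "t \<in> H" using insert.prems by auto
    define Q where "Q = {x\<in>P. \<forall>h'\<in>H - {t}. a h' \<bullet> x < b' h'}"
    obtain x where "x \<in> P" "\<forall>h'\<in>H - {t}. a h' \<bullet> x < b h'"
      using crit[OF t] by (auto simp: infeasible_def)
    then have "x \<in> Q" using ge by (force simp: Q_def)
    have finQ: "finite Q" using \<open>finite P\<close> by (simp add: Q_def)
    define m where "m = Min ((\<lambda>x. a t \<bullet> x) ` Q)"
    have "m \<in> (\<lambda>x. a t \<bullet> x) ` Q" unfolding m_def using finQ \<open>x \<in> Q\<close> by (intro Min_in) auto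
    then obtain y where y: "y \<in> Q" "a t \<bullet> y = m" by auto
    have m_le: "m \<le> a t \<bullet> z" if "z \<in> Q" for z unfolding m_def using finQ that by auto
    have "b' t \<le> m"
    proof -
      obtain h where "h \<in> H" "\<not> a h \<bullet> y < b' h"
        using inf' y(1) by (auto simp: infeasible_def Q_def)
      moreover from this have "h = t" using y(1) by (auto simp: Q_def)
      ultimately show ?thesis using y(2) by auto
    qed
    have inf_new: "infeasible H a (b'(t := m)) P"
      unfolding infeasible_def
    proof (rule ballI, rule ccontr)
      fix z assume z: "z \<in> P" "\<not> (\<exists>h\<in>H. \<not> a h \<bullet> z < (b'(t := m)) h)"
      then have "\<forall>h\<in>H - {t}. a h \<bullet> z < b' h" by (auto split: if_splits)
      with z have "z \<in> Q" by (simp add: Q_def)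
      moreover have "a t \<bullet> z < m" using z(2) t by auto
      ultimately show False using m_le by force
    qed
    have "\<exists>x\<in>P. a h \<bullet> x = (b'(t := m)) h \<and> (\<forall>h'\<in>H - {h}. a h' \<bullet> x < (b'(t := m)) h')"
      if h: "h \<in> insert t T" for h
    proof (cases "h = t")
      case True
      then show ?thesis using y by (intro bexI[of _ y]) (auto simp: Q_def)
    next
      case False
      with h T obtain x where x: "x \<in> P" "a h \<bullet> x = b' h" "\<forall>h'\<in>H - {h}. a h' \<bullet> x < b' h'"
        by auto
      have "a t \<bullet> x < m" using x(3) t False \<open>b' t \<le> m\<close> by force
      then show ?thesis using x False by (intro bexI[of _ x]) auto
    qed
    moreover have "\<forall>h\<in>H. b h \<le> (b'(t := m)) h" using ge \<open>b' t \<le> m\<close> t by force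
    ultimately show ?case using inf_new by blast
  qed
  from this[OF \<open>finite H\<close> order_refl] show ?thesis by blast
qed

text \<open>
  Discarding redundant halfspaces leaves a minimal infeasible family, to which the relaxation
  applies.  The boundary points it provides have pairwise different colours.
\<close>
lemma infeasible_subfamily:
  fixes a :: "'h \<Rightarrow> 'a::real_inner" and colour :: "'a \<Rightarrow> 'c"
  assumes "finite H" and "finite P" and "infeasible H a b P"
    and mid: "\<And>x y. x \<in> P \<Longrightarrow> y \<in> P \<Longrightarrow> colour x = colour y \<Longrightarrow> midpoint x y \<in> P"
  shows "\<exists>H'\<subseteq>H. card H' \<le> card (colour ` P) \<and> infeasible H' a b P"
  using assms(1,3)
proof (induction H rule: finite_psubset_induct)
  case (psubset H)
  show ?case
  proof (cases "\<exists>h\<in>H. infeasible (H - {h}) a b P")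
    case True
    then obtain h where "h \<in> H" "infeasible (H - {h}) a b P" by auto
    then have "\<exists>H'\<subseteq>H - {h}. card H' \<le> card (colour ` P) \<and> infeasible H' a b P"
      by (intro psubset.IH) auto
    then show ?thesis by blast
  next
    case False
    then obtain b' where inf': "infeasible H a b' P"
      and "\<forall>h\<in>H. \<exists>x\<in>P. a h \<bullet> x = b' h \<and> (\<forall>h'\<in>H - {h}. a h' \<bullet> x < b' h')"
      using relax_bounds[OF \<open>finite H\<close> \<open>finite P\<close> psubset.prems] by blast
    then obtain p where p: "\<And>h. h \<in> H \<Longrightarrow> p h \<in> P" "\<And>h. h \<in> H \<Longrightarrow> a h \<bullet> p h = b' h"
      "\<And>h h'. h \<in> H \<Longrightarrow> h' \<in> H \<Longrightarrow> h' \<noteq> h \<Longrightarrow> a h' \<bullet> p h < b' h'"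
      by (metis Diff_iff singletonD)
    have "inj_on (colour \<circ> p) H"
    proof (rule inj_onI, rule ccontr)
      fix g h assume gh: "g \<in> H" "h \<in> H" "(colour \<circ> p) g = (colour \<circ> p) h" "g \<noteq> h"
      have "midpoint (p g) (p h) \<in> P" using gh p(1) by (intro mid) auto
      moreover have "a l \<bullet> midpoint (p g) (p h) < b' l" if l: "l \<in> H" for l
      proof -
        have "a l \<bullet> p g \<le> b' l" "a l \<bullet> p h \<le> b' l" "a l \<bullet> p g < b' l \<or> a l \<bullet> p h < b' l"
          using p(2,3) l gh by (metis order.refl order.strict_implies_order)+
        then show ?thesis by (auto simp: midpoint_def inner_add_right)
      qed
      ultimately show False using inf' by (auto simp: infeasible_def)
    qed
    then have "card H = card ((colour \<circ> p) ` H)" by (rule card_image[symmetric])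
    also have "\<dots> \<le> card (colour ` P)"
      using p(1) \<open>finite P\<close> by (intro card_mono) auto
    finally show ?thesis using psubset.prems by blast
  qed
qed

text \<open>
  A common point \<open>p G\<close> in \<open>S\<close> of each small subfamily \<open>G\<close> is chosen, and each set \<open>C i\<close> is replaced
  by the polytope \<open>K i\<close> spanned by the points \<open>p G\<close> with \<open>i \<in> G\<close>.  Only the finite set \<open>P\<close> of points
  of \<open>S\<close> in the convex hull of all \<open>p G\<close> matters from then on: a point of \<open>P\<close> outside \<open>C i\<close> is
  cut off from \<open>K i\<close> by a halfspace.  If \<open>P\<close> has no point common to all \<open>C i\<close>, these halfspaces
  are infeasible on \<open>P\<close>, hence few of them already are.  But these arise from a small subfamily
  \<open>G\<close> and all contain \<open>p G\<close>.
\<close>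
theorem helly_midpoint_colouring:
  fixes S :: "'a::euclidean_space set" and colour :: "'a \<Rightarrow> 'c" and C :: "'i \<Rightarrow> 'a set"
  assumes colours: "finite (colour ` S)" "card (colour ` S) \<le> N"
    and mid: "\<And>x y. x \<in> S \<Longrightarrow> y \<in> S \<Longrightarrow> colour x = colour y \<Longrightarrow> midpoint x y \<in> S"
    and discrete: "\<And>B. bounded B \<Longrightarrow> finite (S \<inter> B)"
    and "finite I" and conv: "\<And>i. i \<in> I \<Longrightarrow> convex (C i)"
    and helly: "\<And>G. G \<subseteq> I \<Longrightarrow> card G \<le> N \<Longrightarrow> S \<inter> (\<Inter>i\<in>G. C i) \<noteq> {}"
  shows "S \<inter> (\<Inter>i\<in>I. C i) \<noteq> {}"
proof
  assume empty: "S \<inter> (\<Inter>i\<in>I. C i) = {}"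
  define \<G> where "\<G> = {G. G \<subseteq> I \<and> card G \<le> N}"
  have "finite \<G>" using \<open>finite I\<close> by (simp add: \<G>_def)
  have "\<forall>G\<in>\<G>. \<exists>x. x \<in> S \<inter> (\<Inter>i\<in>G. C i)"
    unfolding \<G>_def using helly by blast
  then obtain p where p: "\<And>G. G \<in> \<G> \<Longrightarrow> p G \<in> S" "\<And>G i. G \<in> \<G> \<Longrightarrow> i \<in> G \<Longrightarrow> p G \<in> C i"
    by (metis IntE INT_E)
  define P where "P = S \<inter> convex hull (p ` \<G>)"
  define K where "K i = convex hull (p ` {G\<in>\<G>. i \<in> G})" for i
  have K_sub: "K i \<subseteq> C i" if "i \<in> I" for i
    unfolding K_def using p(2) conv[OF that] by (intro hull_minimal) auto
  have "finite P"
    unfolding P_def using \<open>finite \<G>\<close> by (intro discrete bounded_convex_hull finite_imp_bounded) auto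
  define H where "H = {(i, s). i \<in> I \<and> s \<in> P \<and> s \<notin> C i}"
  have "finite H"
    by (rule finite_subset[of _ "I \<times> P"]) (use \<open>finite I\<close> \<open>finite P\<close> in \<open>auto simp: H_def\<close>)
  have "\<exists>a b. (\<forall>x\<in>K (fst h). a \<bullet> x < b) \<and> \<not> a \<bullet> snd h < b" if h: "h \<in> H" for h
  proof -
    have "closed (K (fst h))"
      unfolding K_def using \<open>finite \<G>\<close>
      by (intro compact_imp_closed compact_convex_hull finite_imp_compact) auto
    moreover have "convex (K (fst h))" by (simp add: K_def)
    moreover have "snd h \<notin> K (fst h)" using h K_sub by (force simp: H_def)
    ultimately obtain a b where ab: "a \<bullet> snd h < b" "\<forall>x\<in>K (fst h). b < a \<bullet> x"
      using separating_hyperplane_closed_point by blast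
    then show ?thesis by (intro exI[of _ "- a"] exI[of _ "- b"]) auto
  qed
  then obtain a b where ab: "\<And>h x. h \<in> H \<Longrightarrow> x \<in> K (fst h) \<Longrightarrow> a h \<bullet> x < b h"
    "\<And>h. h \<in> H \<Longrightarrow> \<not> a h \<bullet> snd h < b h"
    by metis
  have "infeasible H a b P"
    unfolding infeasible_def
  proof
    fix x assume x: "x \<in> P"
    then obtain i where "i \<in> I" "x \<notin> C i" using empty by (auto simp: P_def)
    with x have "(i, x) \<in> H" by (simp add: H_def)
    with ab(2)[of "(i, x)"] show "\<exists>h\<in>H. \<not> a h \<bullet> x < b h" by force
  qed
  moreover have "midpoint x y \<in> P" if "x \<in> P" "y \<in> P" "colour x = colour y" for x y
  proof -
    have "midpoint x y \<in> closed_segment x y" by simp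
    then have "midpoint x y \<in> convex hull (p ` \<G>)"
      using that closed_segment_subset[of x "convex hull (p ` \<G>)" y] by (auto simp: P_def)
    then show ?thesis using that mid by (auto simp: P_def)
  qed
  ultimately obtain H' where H': "H' \<subseteq> H" "card H' \<le> card (colour ` P)" "infeasible H' a b P"
    using infeasible_subfamily[OF \<open>finite H\<close> \<open>finite P\<close>] by metis
  define G where "G = fst ` H'"
  have "finite H'" using H'(1) \<open>finite H\<close> by (rule finite_subset)
  have "card G \<le> card H'" unfolding G_def by (rule card_image_le) fact
  also have "\<dots> \<le> card (colour ` P)" by (rule H')
  also have "\<dots> \<le> card (colour ` S)" by (rule card_mono) (use colours in \<open>auto simp: P_def\<close>)
  also have "\<dots> \<le> N" by (rule colours)
  finally have "G \<in> \<G>" using H'(1) by (auto simp: \<G>_def G_def H_def)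
  then have "p G \<in> P" using p(1) by (auto simp: P_def intro: hull_inc)
  then obtain h where h: "h \<in> H'" "\<not> a h \<bullet> p G < b h" using H'(3) by (auto simp: infeasible_def)
  have "p G \<in> K (fst h)"
    unfolding K_def using \<open>G \<in> \<G>\<close> h(1) by (intro hull_inc) (auto simp: G_def)
  then show False using ab(1) h H'(1) by blast
qed

section \<open>Integer points\<close>

lemma finite_integer_points_bounded:
  fixes B :: "(real ^ 'n) set"
  assumes "bounded B"
  shows "finite (integer_points \<inter> B)"
proof -
  obtain M where M: "\<And>x. x \<in> B \<Longrightarrow> norm x \<le> M" using assms by (auto simp: bounded_iff)
  define A where "A = real_of_int ` {- \<lceil>M\<rceil>..\<lceil>M\<rceil>}"
  have "x $ i \<in> A" if x: "x \<in> integer_points \<inter> B" for x i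
  proof -
    have "\<bar>x $ i\<bar> \<le> M" using component_le_norm_cart[of x i] M[of x] x by auto
    moreover have "x $ i \<in> \<int>" using x by (simp add: integer_points_def)
    then obtain z where z: "x $ i = of_int z" by (auto elim: Ints_cases)
    ultimately have "z \<in> {- \<lceil>M\<rceil>..\<lceil>M\<rceil>}" by (simp add: z) linarith
    then show ?thesis using z by (auto simp: A_def)
  qed
  then have "integer_points \<inter> B \<subseteq> vec_lambda ` (UNIV \<rightarrow>\<^sub>E A)"
    by (auto intro!: image_eqI[of _ vec_lambda "\<lambda>i. _ $ i"])
  moreover have "finite (UNIV \<rightarrow>\<^sub>E A :: ('n \<Rightarrow> real) set)"
    by (intro finite_PiE) (auto simp: A_def)
  ultimately show ?thesis using finite_surj by blast
qed

definition parity :: "real ^ 'n \<Rightarrow> 'n \<Rightarrow> bool" where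
  "parity x = (\<lambda>i. even \<lfloor>x $ i\<rfloor>)"

lemma midpoint_integer_points:
  assumes "x \<in> integer_points" "y \<in> integer_points" "parity x = parity y"
  shows "midpoint x y \<in> integer_points"
  unfolding integer_points_def
proof (rule CollectI, rule allI)
  fix i
  obtain m n where mn: "x $ i = of_int m" "y $ i = of_int n"
    using assms(1,2) by (auto simp: integer_points_def elim!: allE[of _ i] Ints_cases)
  have "even m = even n" using assms(3) mn by (auto simp: parity_def dest!: fun_cong[of _ _ i])
  then obtain l where "m + n = 2 * l" by (metis evenE even_add)
  then have "real_of_int m + real_of_int n = 2 * real_of_int l"
    by (metis of_int_add of_int_mult of_int_numeral)
  then have "midpoint x y $ i = of_int l" by (simp add: midpoint_def mn)
  then show "midpoint x y $ i \<in> \<int>" by simp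
qed

lemma integer_points_add: "x \<in> integer_points \<Longrightarrow> y \<in> integer_points \<Longrightarrow> x + y \<in> integer_points"
  by (simp add: integer_points_def)

lemma integer_points_scale:
  "c \<in> \<int> \<Longrightarrow> x \<in> integer_points \<Longrightarrow> c *\<^sub>R x \<in> integer_points"
  by (simp add: integer_points_def)

lemma integer_points_minus: "x \<in> integer_points \<Longrightarrow> - x \<in> integer_points"
  by (simp add: integer_points_def)

text \<open>
  Finitely many hyperplanes do not cover the space.
\<close>
lemma exists_inner_nonzero:
  fixes W :: "'a::euclidean_space set"
  assumes "finite W" "0 \<notin> W"
  shows "\<exists>a. \<forall>w\<in>W. a \<bullet> w \<noteq> 0"
proof -
  have "negligible (\<Union>w\<in>W. {a. w \<bullet> a = 0})"
    using assms by (intro negligible_Union) (auto intro!: negligible_hyperplane)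
  then have "(\<Union>w\<in>W. {a. w \<bullet> a = 0}) \<noteq> UNIV" using non_negligible_UNIV by metis
  then show ?thesis by (auto simp: inner_commute)
qed

section \<open>Collinear integer points and arithmetic progressions\<close>

text \<open>
  The integer vectors parallel to \<open>u\<close> form a group of rank one.  Each of them is determined by its
  \<open>j\<close>-th coordinate, an integer, for any \<open>j\<close> with \<open>u $ j \<noteq> 0\<close>.  As in the Euclidean algorithm, one
  with least positive \<open>j\<close>-th coordinate generates the group, because division with remainder would
  otherwise produce a smaller one.
\<close>
lemma integer_direction_generator:
  fixes u w :: "real ^ 'n"
  assumes w: "w \<in> integer_points" "w \<noteq> 0" "w = c *\<^sub>R u"
  obtains v where "v \<in> integer_points" "v \<noteq> 0"
    "\<And>x c. x \<in> integer_points \<Longrightarrow> x = c *\<^sub>R u \<Longrightarrow> \<exists>n. x = real_of_int n *\<^sub>R v"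
proof -
  obtain j where j: "w $ j \<noteq> 0" using w(2) by (auto simp: vec_eq_iff)
  then have uj: "u $ j \<noteq> 0" using w(3) by auto
  define L where "L = {x \<in> integer_points. \<exists>c. x = c *\<^sub>R u}"
  have "sgn (w $ j) *\<^sub>R w \<in> L"
    using w integer_points_scale[of "sgn (w $ j)" w] by (auto simp: L_def sgn_if)
  moreover have "(sgn (w $ j) *\<^sub>R w) $ j > 0" using j by (auto simp: sgn_if)
  ultimately have ex: "\<exists>v. v \<in> L \<and> v $ j > 0" by blast
  define v where "v = (ARG_MIN (\<lambda>v. nat \<lfloor>v $ j\<rfloor>) v. v \<in> L \<and> v $ j > 0)"
  have v: "v \<in> L" "v $ j > 0"
    using arg_min_natI[of "\<lambda>v. v \<in> L \<and> v $ j > 0"] ex by (auto simp: v_def)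
  have least: "nat \<lfloor>v $ j\<rfloor> \<le> nat \<lfloor>x $ j\<rfloor>" if "x \<in> L" "x $ j > 0" for x
    unfolding v_def by (rule arg_min_nat_le) (use that in auto)
  obtain d where d: "v = d *\<^sub>R u" using v(1) by (auto simp: L_def)
  show thesis
  proof
    show "v \<in> integer_points" using v(1) by (simp add: L_def)
    show "v \<noteq> 0" using v(2) by auto
    fix x c assume x: "x \<in> integer_points" "x = c *\<^sub>R u"
    define n where "n = \<lfloor>x $ j / v $ j\<rfloor>"
    define r where "r = x - real_of_int n *\<^sub>R v"
    have r: "r = (c - n * d) *\<^sub>R u" by (simp add: r_def x d algebra_simps)
    have r_int: "r \<in> integer_points"
      using x(1) v(1) by (auto simp: r_def L_def integer_points_def)
    have r_ge: "r $ j \<ge> 0" and r_less: "r $ j < v $ j"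
      using floor_divide_lower[OF v(2), of "x $ j"] floor_divide_upper[OF v(2), of "x $ j"]
      by (auto simp: r_def n_def algebra_simps)
    have "r $ j = 0"
    proof (rule ccontr)
      assume "r $ j \<noteq> 0"
      then have "r $ j > 0" using r_ge by simp
      moreover have "r \<in> L" using r r_int by (auto simp: L_def)
      ultimately have "nat \<lfloor>v $ j\<rfloor> \<le> nat \<lfloor>r $ j\<rfloor>" by (rule least[rotated])
      moreover have "r $ j \<in> \<int>" "v $ j \<in> \<int>"
        using r_int v(1) by (auto simp: L_def integer_points_def)
      ultimately show False using r_ge r_less v(2) by (auto elim!: Ints_cases)
    qed
    then have "r = 0" using r uj by auto
    then show "\<exists>n. x = real_of_int n *\<^sub>R v" unfolding r_def by (metis eq_iff_diff_eq_0)
  qed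
qed

lemma convex_contains_between:
  assumes "convex T" "x \<in> T" "x + m *\<^sub>R v \<in> T" and t: "0 \<le> t" "t \<le> m"
  shows "x + t *\<^sub>R v \<in> T"
proof (cases "m = 0")
  case True
  then show ?thesis using assms by simp
next
  case False
  have "x + t *\<^sub>R v = (1 - t / m) *\<^sub>R x + (t / m) *\<^sub>R (x + m *\<^sub>R v)"
    using False by (simp add: algebra_simps)
  also have "\<dots> \<in> T" using t False by (intro convexD[OF assms(1-3)]) auto
  finally show ?thesis .
qed

text \<open>
  Written as \<open>q + n v\<close> with a generator \<open>v\<close> of the integer direction of the line, \<open>k\<close> distinct
  points have \<open>k\<close> distinct parameters \<open>n\<close>; so the largest one exceeds the smallest one by at least
  \<open>k - 1\<close>.  For \<open>k = 1\<close> the direction is arbitrary.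
\<close>
lemma progression_of_collinear:
  fixes T :: "(real ^ 'n) set"
  assumes "convex T" "k > 0" "contains_collinear_integer_points k T"
  shows "\<exists>x v. x \<in> integer_points \<and> v \<in> integer_points \<and> v \<noteq> 0 \<and>
           x \<in> T \<and> x + (real k - 1) *\<^sub>R v \<in> T"
proof -
  obtain P where P: "finite P" "card P = k" "P \<subseteq> T \<inter> integer_points" "collinear P"
    using assms(3) by (auto simp: contains_collinear_integer_points_def)
  obtain q where q: "q \<in> P" using P(2) \<open>k > 0\<close> by fastforce
  show ?thesis
  proof (cases "k = 1")
    case True
    define e :: "real ^ 'n" where "e = (\<chi> i. 1)"
    have "e \<in> integer_points" "e \<noteq> 0" by (auto simp: e_def integer_points_def vec_eq_iff)
    with True q P(3) show ?thesis by (intro exI[of _ q] exI[of _ e]) auto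
  next
    case False
    then have "card P > 1" using \<open>k > 0\<close> P(2) by simp
    then have "P \<noteq> {q}" by auto
    then obtain q' where q': "q' \<in> P" "q' \<noteq> q" using q by blast
    obtain u where u: "\<And>x y. x \<in> P \<Longrightarrow> y \<in> P \<Longrightarrow> \<exists>c. x - y = c *\<^sub>R u"
      using P(4) by (auto simp: collinear_def)
    have diff: "x - y \<in> integer_points" if "x \<in> P" "y \<in> P" for x y
      using that P(3) by (auto simp: integer_points_def subset_iff)
    obtain c where c: "q' - q = c *\<^sub>R u" using u q q' by blast
    obtain v where v: "v \<in> integer_points" "v \<noteq> 0"
      "\<And>x c. x \<in> integer_points \<Longrightarrow> x = c *\<^sub>R u \<Longrightarrow> \<exists>n. x = real_of_int n *\<^sub>R v"
      using integer_direction_generator[OF diff[OF q'(1) q] _ c] q'(2) by auto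
    have "\<forall>x\<in>P. \<exists>n. x - q = real_of_int n *\<^sub>R v" using v(3) u diff q by blast
    then obtain n where n: "\<And>x. x \<in> P \<Longrightarrow> x - q = real_of_int (n x) *\<^sub>R v" by metis
    have inj: "inj_on n P"
      by (rule inj_onI) (metis n diff_add_cancel)
    have nP: "finite (n ` P)" "n ` P \<noteq> {}" using P(1) q by auto
    obtain x where x: "x \<in> P" "n x = Min (n ` P)" using Min_in[OF nP] by auto
    obtain y where y: "y \<in> P" "n y = Max (n ` P)" using Max_in[OF nP] by auto
    have "n ` P \<subseteq> {n x..n y}" using nP x y by auto
    then have "card (n ` P) \<le> card {n x..n y}" by (rule card_mono[rotated]) simp
    then have gap: "int k - 1 \<le> n y - n x"
      using card_image[OF inj] P(2) \<open>k > 0\<close> by simp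
    define D where "D = real_of_int (n y - n x)"
    have D: "real k - 1 \<le> D" unfolding D_def using gap by linarith
    have "y - x = (y - q) - (x - q)" by simp
    also have "\<dots> = D *\<^sub>R v" using n[OF x(1)] n[OF y(1)]
      by (simp only: D_def of_int_diff scaleR_left_diff_distrib)
    finally have yx: "y = x + D *\<^sub>R v" by (simp add: algebra_simps)
    have "x \<in> T" using x(1) P(3) by blast
    moreover have "x + D *\<^sub>R v \<in> T" unfolding yx[symmetric] using y(1) P(3) by blast
    moreover have "0 \<le> real k - 1" using \<open>k > 0\<close> by simp
    ultimately have "x + (real k - 1) *\<^sub>R v \<in> T"
      using D by (rule convex_contains_between[OF assms(1)])
    then show ?thesis using x P(3) v by blast
  qed
qed

lemma collinear_of_progression:
  fixes T :: "(real ^ 'n) set"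
  assumes "convex T" and xv: "x \<in> integer_points" "v \<in> integer_points" "v \<noteq> 0"
    and "x \<in> T" "x + (real k - 1) *\<^sub>R v \<in> T"
  shows "contains_collinear_integer_points k T"
proof -
  define f where "f i = x + real i *\<^sub>R v" for i
  have "inj_on f {..<k}" using xv(3) by (auto simp: f_def inj_on_def)
  moreover have "f i \<in> T" if i: "i < k" for i
    unfolding f_def using i by (intro convex_contains_between[OF assms(1,5,6)]) auto
  moreover have "f i \<in> integer_points" for i
    using xv by (auto simp: f_def intro!: integer_points_add integer_points_scale)
  moreover have "collinear (f ` {..<k})"
    unfolding collinear_def
  proof (intro exI[of _ v] ballI)
    fix y z assume "y \<in> f ` {..<k}" "z \<in> f ` {..<k}"
    then obtain i j where "y = f i" "z = f j" by auto
    then show "\<exists>c. y - z = c *\<^sub>R v"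
      by (intro exI[of _ "real i - real j"]) (simp add: f_def algebra_simps)
  qed
  ultimately show ?thesis
    unfolding contains_collinear_integer_points_def
    by (intro exI[of _ "f ` {..<k}"]) (auto simp: card_image)
qed

section \<open>The Helly number of collinear integer points\<close>

theorem theorem1p7:
  fixes \<F> :: "(real ^ 'n) set set"
    and k :: nat
  assumes "k > 0"
    and "finite \<F>"
    and "\<And>C. C \<in> \<F> \<Longrightarrow> convex C"
    and "\<And>\<G>. \<G> \<subseteq> \<F> \<Longrightarrow> card \<G> \<le> 4 ^ CARD('n) \<Longrightarrow>
           contains_collinear_integer_points k (\<Inter>\<G>)"
  shows "contains_collinear_integer_points k (\<Inter>\<F>)"
proof -
  define \<S> where "\<S> = {\<G>. \<G> \<subseteq> \<F> \<and> card \<G> \<le> 4 ^ CARD('n)}"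
  have "\<forall>\<G>\<in>\<S>. \<exists>x v. x \<in> integer_points \<and> v \<in> integer_points \<and> v \<noteq> 0 \<and>
      x \<in> \<Inter>\<G> \<and> x + (real k - 1) *\<^sub>R v \<in> \<Inter>\<G>"
  proof
    fix \<G> assume \<G>: "\<G> \<in> \<S>"
    have "convex (\<Inter>\<G>)" using \<G> assms(3) by (intro convex_Inter) (auto simp: \<S>_def)
    then show "\<exists>x v. x \<in> integer_points \<and> v \<in> integer_points \<and> v \<noteq> 0 \<and>
        x \<in> \<Inter>\<G> \<and> x + (real k - 1) *\<^sub>R v \<in> \<Inter>\<G>"
      using \<G> assms(1,4) by (intro progression_of_collinear) (auto simp: \<S>_def)
  qed
  then obtain x v where xv: "\<And>\<G>. \<G> \<in> \<S> \<Longrightarrow> x \<G> \<in> integer_points \<and> v \<G> \<in> integer_points \<and>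
      v \<G> \<noteq> 0 \<and> x \<G> \<in> \<Inter>\<G> \<and> x \<G> + (real k - 1) *\<^sub>R v \<G> \<in> \<Inter>\<G>"
    by metis
  have "finite \<S>" using \<open>finite \<F>\<close> by (simp add: \<S>_def)
  then have "\<exists>a. \<forall>w\<in>v ` \<S>. a \<bullet> w \<noteq> 0" by (intro exists_inner_nonzero) (use xv in auto)
  then obtain a where a: "\<And>\<G>. \<G> \<in> \<S> \<Longrightarrow> a \<bullet> v \<G> \<noteq> 0" by auto
  define S where "S = {(x :: real ^ 'n, v). x \<in> integer_points \<and> v \<in> integer_points \<and> a \<bullet> v > 0}"
  define lift where
    "lift C = {(x, v). x \<in> C \<and> x + (real k - 1) *\<^sub>R v \<in> C}" for C :: "(real ^ 'n) set"
  define colour where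
    "colour = map_prod (parity :: real ^ 'n \<Rightarrow> _) (parity :: real ^ 'n \<Rightarrow> _)"
  have "S \<inter> (\<Inter>C\<in>\<F>. lift C) \<noteq> {}"
  proof (rule helly_midpoint_colouring[where N = "4 ^ CARD('n)" and colour = colour])
    show "finite (colour ` S)" by simp
    have "card (colour ` S) \<le> CARD(('n \<Rightarrow> bool) \<times> ('n \<Rightarrow> bool))" by (rule card_mono) auto
    also have "\<dots> = 4 ^ CARD('n)" by (simp add: card_fun flip: power_mult_distrib)
    finally show "card (colour ` S) \<le> 4 ^ CARD('n)" .
  next
    fix y z assume yz: "y \<in> S" "z \<in> S" "colour y = colour z"
    have "midpoint y z = (midpoint (fst y) (fst z), midpoint (snd y) (snd z))"
      by (simp add: midpoint_def prod_eq_iff)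
    moreover have "midpoint (fst y) (fst z) \<in> integer_points"
        "midpoint (snd y) (snd z) \<in> integer_points"
      using yz by (auto simp: S_def colour_def intro!: midpoint_integer_points)
    moreover have "a \<bullet> midpoint (snd y) (snd z) > 0"
      using yz by (auto simp: S_def midpoint_def inner_add_right)
    ultimately show "midpoint y z \<in> S" by (simp add: S_def)
  next
    fix B :: "((real ^ 'n) \<times> (real ^ 'n)) set" assume "bounded B"
    then have "finite ((integer_points \<inter> fst ` B) \<times> (integer_points \<inter> snd ` B))"
      by (intro finite_cartesian_product finite_integer_points_bounded bounded_fst bounded_snd)
    then show "finite (S \<inter> B)" by (rule rev_finite_subset) (force simp: S_def)
  next
    show "finite \<F>" by fact
  next
    fix C assume "C \<in> \<F>"
    then have C: "convex C" by (rule assms(3))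
    show "convex (lift C)"
    proof (rule convexI)
      fix y z :: "(real ^ 'n) \<times> (real ^ 'n)" and s t :: real
      assume yz: "y \<in> lift C" "z \<in> lift C" and st: "0 \<le> s" "0 \<le> t" "s + t = 1"
      have "s *\<^sub>R fst y + t *\<^sub>R fst z \<in> C"
        using yz st by (intro convexD[OF C]) (auto simp: lift_def)
      moreover have "s *\<^sub>R (fst y + (real k - 1) *\<^sub>R snd y) +
          t *\<^sub>R (fst z + (real k - 1) *\<^sub>R snd z) \<in> C"
        using yz st by (intro convexD[OF C]) (auto simp: lift_def)
      ultimately show "s *\<^sub>R y + t *\<^sub>R z \<in> lift C"
        by (simp add: lift_def case_prod_beta algebra_simps)
    qed
  next
    fix \<G> assume "\<G> \<subseteq> \<F>" "card \<G> \<le> 4 ^ CARD('n)"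
    then have \<G>: "\<G> \<in> \<S>" by (simp add: \<S>_def)
    show "S \<inter> (\<Inter>C\<in>\<G>. lift C) \<noteq> {}"
    proof (cases "a \<bullet> v \<G> > 0")
      case True
      then have "(x \<G>, v \<G>) \<in> S \<inter> (\<Inter>C\<in>\<G>. lift C)" using xv[OF \<G>] by (auto simp: S_def lift_def)
      then show ?thesis by blast
    next
      \<comment> \<open>The progression has the wrong orientation and is traversed from its other end.\<close>
      case False
      then have "a \<bullet> v \<G> < 0" using a[OF \<G>] by simp
      moreover have "x \<G> + (real k - 1) *\<^sub>R v \<G> \<in> integer_points"
        using xv[OF \<G>] by (intro integer_points_add integer_points_scale) auto
      ultimately have "(x \<G> + (real k - 1) *\<^sub>R v \<G>, - v \<G>) \<in> S \<inter> (\<Inter>C\<in>\<G>. lift C)"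
        using xv[OF \<G>] by (auto simp: S_def lift_def integer_points_minus)
      then show ?thesis by blast
    qed
  qed
  then obtain y w where yw: "(y, w) \<in> S" "\<And>C. C \<in> \<F> \<Longrightarrow> (y, w) \<in> lift C" by fast
  have "w \<noteq> 0" using yw(1) by (auto simp: S_def)
  moreover have "convex (\<Inter>\<F>)" using assms(3) by (rule convex_Inter)
  ultimately show ?thesis
    using yw by (intro collinear_of_progression[of _ y w]) (auto simp: S_def lift_def)
qed

end
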